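(* In Twyst-off extended to allow stacks of size $\infty$, the six-stack position $(\infty,\infty,\infty,\infty,\infty,\infty)$ is an $N$ position.
   Context: Twyst-off with infinite stacks is a two-player impartial game (players alternate; normal play: the last player to move legally wins). A position is a finite ordered sequence of stacks, each stack size being a nonnegative integer or the symbol $\infty$. Positions are subject to the identifications: an end stack of size $0$ is deleted; an interior stack of size $0$ is deleted and its two neighbors $x,y$ are combined into one stack of size $x+y$, where the sum is $\infty$ if $x$ or $y$ is $\infty$. From a position with all stacks nonzero, a move is one of: (i) remove $k\ge1$ tiles from a finite first or last stack; (ii) reduce a first or last stack of size $\infty$ to any finite size (including $0$); (iii) remove the same number $k\ge 1$ of tiles from two consecutive finite stacks; (iv) reduce two consecutive stacks $(\infty,\infty)$ to $(a,a)$ for some finite $a\ge0$; (v) reduce two consecutive stacks $(\infty,b)$ or $(b,\infty)$, with $b$ finite, to $(\infty,b')$ or $(b',\infty)$ respectively, for some $0\le b'<b$. After a move the identifications are applied. Every play is finite. A position is $P$ if the second player can force a win (no option is $P$), and $N$ if the first player can force a win (some option is $P$). *)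

theory Defs
  imports "HOL-Library.Extended_Nat"
begin

type_synonym position = "enat list"

inductive ident :: "position \<Rightarrow> position \<Rightarrow> bool" where
  ident_first: "ident (0 # s) s"
| ident_last: "ident (s @ [0]) s"
| ident_inner: "ident (s @ x # 0 # y # t) (s @ (x + y) # t)"

inductive take_tiles :: "position \<Rightarrow> position \<Rightarrow> bool" where
  first_fin: "1 \<le> k \<Longrightarrow> k \<le> a \<Longrightarrow> take_tiles (enat a # s) (enat (a - k) # s)"
| last_fin: "1 \<le> k \<Longrightarrow> k \<le> a \<Longrightarrow> take_tiles (s @ [enat a]) (s @ [enat (a - k)])"
| first_inf: "take_tiles (\<infinity> # s) (enat a # s)"
| last_inf: "take_tiles (s @ [\<infinity>]) (s @ [enat a])"
| pair_fin: "1 \<le> k \<Longrightarrow> k \<le> a \<Longrightarrow> k \<le> b \<Longrightarrow>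
    take_tiles (s @ enat a # enat b # t) (s @ enat (a - k) # enat (b - k) # t)"
| pair_inf: "take_tiles (s @ \<infinity> # \<infinity> # t) (s @ enat a # enat a # t)"
| inf_fin: "b' < b \<Longrightarrow> take_tiles (s @ \<infinity> # enat b # t) (s @ \<infinity> # enat b' # t)"
| fin_inf: "b' < b \<Longrightarrow> take_tiles (s @ enat b # \<infinity> # t) (s @ enat b' # \<infinity> # t)"

text \<open>The identifications are applied until no stack of size 0 is left; the result does not
  depend on the order (lemma \<open>ident_normal_iff\<close> below).\<close>

definition move :: "position \<Rightarrow> position \<Rightarrow> bool" where
  "move p q \<longleftrightarrow> 0 \<notin> set p \<and> 0 \<notin> set q \<and> (\<exists>r. take_tiles p r \<and> ident\<^sup>*\<^sup>* r q)"

text \<open>The least fixed point says that the second (resp. first) player can force a win in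
  finitely many moves. As every play is finite, it yields the usual recursive
  characterisation and the dichotomy (lemmas \<open>P_position_iff\<close>, \<open>N_position_iff\<close> and
  \<open>N_iff_not_P\<close> below).\<close>

inductive P_position :: "position \<Rightarrow> bool" and N_position :: "position \<Rightarrow> bool" where
  P_positionI: "(\<And>q. move p q \<Longrightarrow> N_position q) \<Longrightarrow> P_position p"
| N_positionI: "move p q \<Longrightarrow> P_position q \<Longrightarrow> N_position p"

fun collapse_from :: "enat \<Rightarrow> position \<Rightarrow> position" where
  "collapse_from x [] = [x]"
| "collapse_from x [y] = (if y = 0 then [x] else [x, y])"
| "collapse_from x (y # z # s) =
    (if y = 0 then collapse_from (x + z) s else x # collapse_from y (z # s))"

fun collapse :: "position \<Rightarrow> position" where
  "collapse [] = []"
| "collapse (x # s) = (if x = 0 then collapse s else collapse_from x s)"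

lemma collapse_from_zero: "collapse_from x (0 # y # s) = collapse_from (x + y) s"
  by simp

lemma collapse_from_nonzero: "y \<noteq> 0 \<Longrightarrow> collapse_from x (y # s) = x # collapse_from y s"
  by (cases s) auto

lemma collapse_from_last: "collapse_from x (s @ [0]) = collapse_from x s"
proof (induction x s rule: collapse_from.induct)
  case (3 x y z s)
  then show ?case by (cases "y = 0") (auto simp: collapse_from_nonzero)
qed auto

lemma collapse_last: "collapse (s @ [0]) = collapse s"
  by (induction s) (auto simp: collapse_from_last)

lemma collapse_from_inner:
  "collapse_from x (s @ a # 0 # b # t) = collapse_from x (s @ (a + b) # t)"
proof (induction x s rule: collapse_from.induct)
  case (1 x)
  then show ?case by (cases "a = 0") (auto simp: collapse_from_nonzero)
next
  case (2 x y)
  then show ?case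
    by (cases "y = 0"; cases "a = 0") (auto simp: collapse_from_nonzero add.assoc)
next
  case (3 x y z s)
  then show ?case by (cases "y = 0") (auto simp: collapse_from_nonzero)
qed

lemma collapse_inner: "collapse (s @ a # 0 # b # t) = collapse (s @ (a + b) # t)"
  by (induction s) (auto simp: collapse_from_inner)

lemma collapse_ident: "ident r q \<Longrightarrow> collapse r = collapse q"
  by (induction rule: ident.induct) (simp_all add: collapse_last collapse_inner)

lemma collapse_ident_rtrancl: "ident\<^sup>*\<^sup>* r q \<Longrightarrow> collapse r = collapse q"
  by (induction rule: rtranclp_induct) (simp_all add: collapse_ident)

lemma collapse_from_id: "0 \<notin> set s \<Longrightarrow> collapse_from x s = x # s"
  by (induction x s rule: collapse_from.induct) auto

lemma collapse_id: "0 \<notin> set s \<Longrightarrow> collapse s = s"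
  by (cases s) (auto simp: collapse_from_id)

lemma zero_notin_collapse_from: "x \<noteq> 0 \<Longrightarrow> 0 \<notin> set (collapse_from x s)"
  by (induction x s rule: collapse_from.induct) (auto simp: plus_eq_infty_iff_enat)

lemma zero_notin_collapse: "0 \<notin> set (collapse s)"
  by (induction s) (auto simp: zero_notin_collapse_from)

lemma ident_collapse_from: "ident\<^sup>*\<^sup>* (p @ x # s) (p @ collapse_from x s)"
proof (induction x s arbitrary: p rule: collapse_from.induct)
  case (2 x y)
  show ?case using ident_last[of "p @ [x]"] by auto
next
  case (3 x y z s)
  show ?case
  proof (cases "y = 0")
    case True
    then show ?thesis
      using 3(1)[OF True, of p] ident_inner[of p x z s]
      by (auto intro: converse_rtranclp_into_rtranclp)
  next
    case False
    then show ?thesis using 3(2)[OF False, of "p @ [x]"] by simp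
  qed
qed auto

lemma ident_collapse: "ident\<^sup>*\<^sup>* s (collapse s)"
proof (induction s)
  case (Cons x s)
  show ?case
  proof (cases "x = 0")
    case True
    then show ?thesis
      using Cons ident_first[of s] by (auto intro: converse_rtranclp_into_rtranclp)
  next
    case False
    then show ?thesis using ident_collapse_from[of "[]" x s] by simp
  qed
qed auto

lemma ident_normal_iff: "ident\<^sup>*\<^sup>* r q \<and> 0 \<notin> set q \<longleftrightarrow> q = collapse r"
  using collapse_ident_rtrancl collapse_id ident_collapse zero_notin_collapse by metis

lemma move_iff: "move p q \<longleftrightarrow> 0 \<notin> set p \<and> (\<exists>r. take_tiles p r \<and> q = collapse r)"
  unfolding move_def using ident_normal_iff by blast

definition weight :: "position \<Rightarrow> nat \<times> nat" where
  "weight p = (\<Sum>x\<leftarrow>p. if x = \<infinity> then 1 else 0, \<Sum>x\<leftarrow>p. if x = \<infinity> then 0 else the_enat x)"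

lemma ident_weight:
  "ident r q \<Longrightarrow> weight q = weight r \<or> (weight q, weight r) \<in> less_than <*lex*> less_than"
proof (induction rule: ident.induct)
  case (ident_inner s x y t)
  then show ?case by (cases x; cases y) (auto simp: weight_def)
qed (auto simp: weight_def zero_enat_def)

lemma ident_rtrancl_weight:
  "ident\<^sup>*\<^sup>* r q \<Longrightarrow> weight q = weight r \<or> (weight q, weight r) \<in> less_than <*lex*> less_than"
proof (induction rule: rtranclp_induct)
  case (step y z)
  have "trans (less_than <*lex*> less_than)" by (intro trans_lex_prod trans_less_than)
  then show ?case using ident_weight[OF step(2)] step(3) by (metis transD)
qed simp

lemma take_tiles_weight: "take_tiles p r \<Longrightarrow> (weight r, weight p) \<in> less_than <*lex*> less_than"
  by (induction rule: take_tiles.induct) (auto simp: weight_def)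

lemma wf_move: "wf {(q, p). move p q}"
proof (rule wf_subset)
  show "wf (inv_image (less_than <*lex*> less_than) weight)" by auto
  have "(weight q, weight p) \<in> less_than <*lex*> less_than" if "move p q" for p q
  proof -
    from that obtain r where r: "take_tiles p r" "ident\<^sup>*\<^sup>* r q"
      unfolding move_def by blast
    have "trans (less_than <*lex*> less_than)" by (intro trans_lex_prod trans_less_than)
    then show ?thesis
      using ident_rtrancl_weight[OF r(2)] take_tiles_weight[OF r(1)] by (metis transD)
  qed
  then show "{(q, p). move p q} \<subseteq> inv_image (less_than <*lex*> less_than) weight"
    by (auto simp: inv_image_def simp del: in_lex_prod)
qed

lemma N_position_iff: "N_position p \<longleftrightarrow> (\<exists>q. move p q \<and> P_position q)"
  by (meson N_position.cases N_positionI)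

lemma N_iff_not_P: "N_position p \<longleftrightarrow> \<not> P_position p"
proof (induction p rule: wf_induct_rule[OF wf_move])
  case (1 p)
  then have "\<And>q. move p q \<Longrightarrow> N_position q \<longleftrightarrow> \<not> P_position q" by simp
  then show ?case by (metis N_position_iff P_position.simps)
qed

lemma P_position_iff: "P_position p \<longleftrightarrow> \<not> (\<exists>q. move p q \<and> P_position q)"
  using N_iff_not_P N_position_iff by blast

end

theory Submission
  imports Defs
begin

text \<open>The first player moves to \<open>(\<infinity>,\<infinity>,1,1,\<infinity>,\<infinity>)\<close>. The options \<open>(\<infinity>,\<infinity>,\<infinity>,\<infinity>)\<close> and
  \<open>(\<infinity>,1,1,\<infinity>,\<infinity>)\<close> of that position are answered by \<open>(\<infinity>,1,1,\<infinity>)\<close>, which is \<open>P\<close>. The other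
  options end (up to reversal) in \<open>\<infinity>\<close> and are \<open>N\<close> by a non-constructive pigeonhole
  argument: if every \<open>(s,c)\<close> with \<open>c\<close> finite were \<open>N\<close>, then each of them would have a \<open>P\<close> option
  that still depends on \<open>c\<close>. These options form finitely many families, in each of which larger
  \<open>c\<close> move to smaller ones, so each family contains at most one \<open>P\<close> position. Hence some
  \<open>(s,c)\<close> is \<open>P\<close>, and \<open>(s,\<infinity>)\<close> is \<open>N\<close>.\<close>

section \<open>Enumeration of moves on explicit positions\<close>

definition pair_reduce :: "enat \<Rightarrow> enat \<Rightarrow> enat \<Rightarrow> enat \<Rightarrow> bool" where
  "pair_reduce x y x' y' \<longleftrightarrow>
    (\<exists>a b k. x = enat a \<and> y = enat b \<and> 1 \<le> k \<and> k \<le> a \<and> k \<le> b \<and> x' = enat (a - k) \<and> y' = enat (b - k)) \<or>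
    (\<exists>a. x = \<infinity> \<and> y = \<infinity> \<and> x' = enat a \<and> y' = enat a) \<or>
    (\<exists>b b'. x = \<infinity> \<and> y = enat b \<and> b' < b \<and> x' = \<infinity> \<and> y' = enat b') \<or>
    (\<exists>b b'. x = enat b \<and> y = \<infinity> \<and> b' < b \<and> x' = enat b' \<and> y' = \<infinity>)"

text \<open>Recursion on the list replaces the splitting \<open>s @ x # y # t\<close>, so
  simplification can list all pair moves of an explicitly given position.\<close>

fun pair_take :: "position \<Rightarrow> position \<Rightarrow> bool" where
  "pair_take (x # y # t) r \<longleftrightarrow>
    (\<exists>x' y'. pair_reduce x y x' y' \<and> r = x' # y' # t) \<or> (\<exists>r'. pair_take (y # t) r' \<and> r = x # r')"
| "pair_take _ r \<longleftrightarrow> False"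

lemma pair_take_append: "pair_reduce x y x' y' \<Longrightarrow> pair_take (s @ x # y # t) (s @ x' # y' # t)"
proof (induction s)
  case (Cons z s)
  then show ?case by (cases s) auto
qed auto

lemma less_enat_iff: "x' < x \<longleftrightarrow> (\<exists>a'. x' = enat a' \<and> (x = \<infinity> \<or> (\<exists>a. x = enat a \<and> a' < a)))"
  by (cases x; cases x') auto

lemma take_tiles_cases:
  assumes "take_tiles p r"
  obtains (first) x' where "x' < hd p" "r = x' # tl p"
  | (last) x' where "x' < last p" "r = butlast p @ [x']"
  | (pair) "pair_take p r"
  using assms
proof (cases rule: take_tiles.cases)
  case (first_fin k a s)
  then show ?thesis using first[of "enat (a - k)"] by simp
next
  case (last_fin k a s)
  then show ?thesis using last[of "enat (a - k)"] by simp
next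
  case (first_inf s a)
  then show ?thesis using first[of "enat a"] by simp
next
  case (last_inf s a)
  then show ?thesis using last[of "enat a"] by simp
next
  case (pair_fin k a b s t)
  show ?thesis
    by (rule pair, unfold pair_fin(1,2), rule pair_take_append)
      (use pair_fin in \<open>auto simp: pair_reduce_def\<close>)
next
  case (pair_inf s t a)
  show ?thesis
    by (rule pair, unfold pair_inf(1,2), rule pair_take_append)
      (use pair_inf in \<open>auto simp: pair_reduce_def\<close>)
next
  case (inf_fin b' b s t)
  show ?thesis
    by (rule pair, unfold inf_fin(1,2), rule pair_take_append)
      (use inf_fin in \<open>auto simp: pair_reduce_def\<close>)
next
  case (fin_inf b' b s t)
  show ?thesis
    by (rule pair, unfold fin_inf(1,2), rule pair_take_append)
      (use fin_inf in \<open>auto simp: pair_reduce_def\<close>)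
qed

lemma take_tiles_last: "x' < x \<Longrightarrow> take_tiles (s @ [x]) (s @ [x'])"
  using take_tiles.last_fin[of "a - a'" a s for a a'] take_tiles.last_inf
  by (cases x; cases x') (fastforce, auto)

lemma take_tiles_imp_move: "take_tiles p r \<Longrightarrow> 0 \<notin> set p \<Longrightarrow> move p (collapse r)"
  using move_iff by blast

lemma move_last: "0 \<notin> set s \<Longrightarrow> x' < x \<Longrightarrow> move (s @ [x]) (collapse (s @ [x']))"
  by (rule take_tiles_imp_move[OF take_tiles_last]) auto

lemma P_take_tilesI: "(\<And>r. take_tiles p r \<Longrightarrow> N_position (collapse r)) \<Longrightarrow> P_position p"
  by (rule P_positionI) (auto simp: move_iff)

lemma N_take_tilesE:
  assumes "\<not> P_position p" "0 \<notin> set p"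
  obtains r where "take_tiles p r" "P_position (collapse r)"
  using assms by (metis N_iff_not_P N_position_iff move_iff)

section \<open>Pigeonhole criteria for a last stack \<infinity>\<close>

text \<open>No move joins two P positions, so at most one \<open>f c\<close> with \<open>c\<close>
  at least 1 is P. The value 0 is left out because an empty last stack is deleted and changes the
  shape of the position.\<close>

definition chain :: "(nat \<Rightarrow> position) \<Rightarrow> bool" where
  "chain f \<longleftrightarrow> (\<forall>c d. 1 \<le> c \<longrightarrow> c < d \<longrightarrow> move (f d) (f c))"

lemma N_infinite_last:
  assumes s: "0 \<notin> set s" and F: "finite F" "\<And>f. f \<in> F \<Longrightarrow> chain f"
    and opt: "\<And>c r. 1 \<le> c \<Longrightarrow> take_tiles (s @ [enat c]) r \<Longrightarrow>
      (\<exists>c'. r = s @ [enat c']) \<or> (\<exists>f\<in>F. collapse r = f c)"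
  shows "N_position (s @ [\<infinity>])"
proof (rule ccontr)
  assume *: "\<not> N_position (s @ [\<infinity>])"
  \<comment> \<open>The case \<open>c = 0\<close> is included, since emptying the infinite stack is
    also a move; this rules out every option of the form \<open>s @ [enat c']\<close> below.\<close>
  have last: "\<not> P_position (collapse (s @ [enat c]))" for c
    using * N_positionI move_last[OF s, of "enat c" \<infinity>] by auto
  have "\<exists>f\<in>F. P_position (f c)" if c: "1 \<le> c" for c
  proof -
    have nz: "0 \<notin> set (s @ [enat c])" using s c by (auto simp: zero_enat_def)
    then obtain r where r: "take_tiles (s @ [enat c]) r" "P_position (collapse r)"
      using last[of c] by (metis collapse_id N_take_tilesE)
    then show ?thesis using opt[OF c r(1)] last by metis
  qed
  then obtain g where g: "\<And>c. 1 \<le> c \<Longrightarrow> g c \<in> F" "\<And>c. 1 \<le> c \<Longrightarrow> P_position (g c c)"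
    by metis
  \<comment> \<open>If \<open>g c = g d\<close> with \<open>c < d\<close>, then the P position
    \<open>g d d\<close> would move to the P position \<open>g c c\<close> of the same
    chain.\<close>
  have "inj_on g {1..}"
  proof (rule linorder_inj_onI')
    fix c d :: nat assume cd: "c \<in> {1..}" "d \<in> {1..}" "c < d"
    then have "move (g d d) (g d c)" using F(2) g(1) by (auto simp: chain_def)
    then show "g c \<noteq> g d" using g(2) cd by (metis N_iff_not_P N_positionI atLeast_iff)
  qed
  moreover have "g ` {1..} \<subseteq> F" using g(1) by auto
  ultimately have "finite {1::nat..}" using F(1) inj_on_finite by blast
  then show False using infinite_Ici by blast
qed

lemma chain_append: "0 \<notin> set s \<Longrightarrow> chain (\<lambda>c. s @ [enat c])"
  unfolding chain_def
proof (intro allI impI)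
  fix c d :: nat assume "0 \<notin> set s" "1 \<le> c" "c < d"
  then show "move (s @ [enat d]) (s @ [enat c])"
    using move_last[of s "enat c" "enat d"] by (simp add: collapse_id zero_enat_def)
qed

text \<open>Whatever merges into \<infinity> from the left is absorbed, and a nonzero last stack
  stays separate; hence one prefix \<open>w\<close> serves all \<open>c\<close>.\<close>

lemma collapse_from_infinity_last:
  "\<exists>w. \<forall>c\<ge>1. collapse_from x (u @ [\<infinity>, enat c]) = w @ [\<infinity>, enat c]"
proof (induction x u rule: collapse_from.induct)
  case (1 x)
  then show ?case by (auto intro!: exI[of _ "[x]"] simp: zero_enat_def)
next
  case (2 x y)
  show ?case
  proof (cases "y = 0")
    case True
    then show ?thesis by (auto intro!: exI[of _ "[]"] simp: zero_enat_def)
  next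
    case False
    then show ?thesis by (auto intro!: exI[of _ "[x, y]"] simp: zero_enat_def)
  qed
next
  case (3 x y z s)
  show ?case
  proof (cases "y = 0")
    case True
    then show ?thesis using 3(1) by simp
  next
    case False
    then obtain w where "\<forall>c\<ge>1. collapse_from y ((z # s) @ [\<infinity>, enat c]) = w @ [\<infinity>, enat c]"
      using 3(2) by blast
    then show ?thesis using False by (auto intro!: exI[of _ "x # w"])
  qed
qed

lemma collapse_infinity_last:
  "\<exists>w. \<forall>c\<ge>1. collapse (u @ [\<infinity>, enat c]) = w @ [\<infinity>, enat c]"
proof (induction u)
  case Nil
  then show ?case by (auto intro!: exI[of _ "[]"] simp: zero_enat_def)
next
  case (Cons x u)
  then show ?case using collapse_from_infinity_last by (cases "x = 0") simp_all
qed

lemma chain_collapse_infinity: "chain (\<lambda>c. collapse (u @ [\<infinity>, enat c]))"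
proof -
  obtain w where w: "\<And>c. 1 \<le> c \<Longrightarrow> collapse (u @ [\<infinity>, enat c]) = w @ [\<infinity>, enat c]"
    using collapse_infinity_last by metis
  have "0 \<notin> set (w @ [\<infinity>])" using w[of 1] zero_notin_collapse[of "u @ [\<infinity>, enat 1]"] by auto
  from chain_append[OF this] show ?thesis unfolding chain_def by (auto simp: w)
qed

text \<open>A finite last stack beside \<infinity> can only be reduced alone. If the stack before
  that \<infinity> is finite, every other option leaves the ending
  \<open>[\<infinity>, enat c]\<close> intact, so finitely many prefixes \<open>u\<close> describe
  the families.\<close>

lemma N_infinity_infinity_last:
  assumes s: "0 \<notin> set s" and U: "finite U"
    and opt: "\<And>c r. 1 \<le> c \<Longrightarrow> take_tiles (s @ [\<infinity>, enat c]) r \<Longrightarrow>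
      (\<exists>c'. r = s @ [\<infinity>, enat c']) \<or> (\<exists>u\<in>U. r = u @ [\<infinity>, enat c])"
  shows "N_position (s @ [\<infinity>, \<infinity>])"
proof -
  have "N_position ((s @ [\<infinity>]) @ [\<infinity>])"
  proof (rule N_infinite_last)
    show "finite ((\<lambda>u c. collapse (u @ [\<infinity>, enat c])) ` U)" using U by simp
  qed (use s opt chain_collapse_infinity in fastforce)+
  then show ?thesis by simp
qed

section \<open>N positions found by pigeonhole\<close>

lemma N_a_1_1_inf:
  assumes a: "1 \<le> a"
  shows "N_position [enat a, 1, 1, \<infinity>]"
proof -
  \<comment> \<open>All three pair moves collapse to \<open>[enat a, enat c]\<close>: a tile lost
    next to an emptied stack is made up by the 1 merged into it. The other members come from
    reducing the first stack, to 0 or to \<open>k\<close>.\<close>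
  let ?F = "insert (\<lambda>c. [enat a] @ [enat c]) (insert (\<lambda>c. [1, 1] @ [enat c])
    ((\<lambda>k c. [enat k, 1, 1] @ [enat c]) ` {1..<a}))"
  have "N_position ([enat a, 1, 1] @ [\<infinity>])"
  proof (rule N_infinite_last)
    show "0 \<notin> set [enat a, 1, 1]" using a by (auto simp: enat_0_iff)
    show "finite ?F" by simp
    show "chain f" if "f \<in> ?F" for f
      using that a by (auto simp del: append.simps intro!: chain_append) (auto simp: enat_0_iff)
    fix c r assume c: "1 \<le> c" and r: "take_tiles ([enat a, 1, 1] @ [enat c]) r"
    from r show "(\<exists>c'. r = [enat a, 1, 1] @ [enat c']) \<or> (\<exists>f\<in>?F. collapse r = f c)"
    proof (cases rule: take_tiles_cases)
      case (first x')
      then obtain k where k: "x' = enat k" "k < a" by (auto simp: less_enat_iff)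
      show ?thesis
      proof (cases "k = 0")
        case True
        then show ?thesis using first k c by (auto simp: zero_enat_def one_enat_def)
      next
        case False
        then show ?thesis using first k c by (auto simp: zero_enat_def one_enat_def)
      qed
    next
      case (last x')
      then show ?thesis by (auto simp: less_enat_iff)
    next
      case pair
      then show ?thesis using a c
        by (cases "a = 1") (auto simp: pair_reduce_def zero_enat_def one_enat_def le_Suc_eq)
    qed
  qed
  then show ?thesis by simp
qed

lemma N_1_1_inf: "N_position [1, 1, \<infinity>]"
proof -
  have "N_position ([1, 1] @ [\<infinity>])"
  proof (rule N_infinite_last)
    let ?F = "{\<lambda>c. [] @ [enat c], \<lambda>c. [1] @ [enat c]}"
    show "finite ?F" by simp
    show "chain f" if "f \<in> ?F" for f
      using that by (auto simp del: append.simps intro!: chain_append)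
    fix c r assume c: "1 \<le> c" and r: "take_tiles ([1, 1] @ [enat c]) r"
    from r show "(\<exists>c'. r = [1, 1] @ [enat c']) \<or> (\<exists>f\<in>?F. collapse r = f c)"
    proof (cases rule: take_tiles_cases)
      case pair
      then show ?thesis using c
        by (auto simp: pair_reduce_def zero_enat_def one_enat_def le_Suc_eq)
    qed (use c in \<open>auto simp: less_enat_iff zero_enat_def one_enat_def\<close>)
  qed simp
  then show ?thesis by simp
qed

lemma N_b_b_1_1_inf_inf:
  assumes b: "1 \<le> b"
  shows "N_position [enat b, enat b, 1, 1, \<infinity>, \<infinity>]"
proof -
  \<comment> \<open>The three explicit prefixes come from the pairs \<open>(b,1)\<close>,
    \<open>(1,1)\<close> and \<open>(1,\<infinity>)\<close>; the images come from the first stack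
    and from the pair \<open>(b,b)\<close>.\<close>
  let ?U = "{[enat b, enat (b - 1), 0, 1], [enat b, enat b, 0, 0], [enat b, enat b, 1, 0]} \<union>
    (\<lambda>k. [enat k, enat b, 1, 1]) ` {..<b} \<union> (\<lambda>k. [enat k, enat k, 1, 1]) ` {..<b}"
  have "N_position ([enat b, enat b, 1, 1] @ [\<infinity>, \<infinity>])"
  proof (rule N_infinity_infinity_last)
    show "0 \<notin> set [enat b, enat b, 1, 1]" using b by (auto simp: enat_0_iff)
    show "finite ?U" by simp
    fix c r assume c: "1 \<le> c" and r: "take_tiles ([enat b, enat b, 1, 1] @ [\<infinity>, enat c]) r"
    from r show "(\<exists>c'. r = [enat b, enat b, 1, 1] @ [\<infinity>, enat c']) \<or>
      (\<exists>u\<in>?U. r = u @ [\<infinity>, enat c])"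
    proof (cases rule: take_tiles_cases)
      case pair
      then show ?thesis using b c
        by (auto simp: pair_reduce_def zero_enat_def one_enat_def le_Suc_eq)
    qed (use b c in \<open>auto simp: less_enat_iff\<close>)
  qed
  then show ?thesis by simp
qed

lemma N_1_1_inf_inf: "N_position [1, 1, \<infinity>, \<infinity>]"
proof -
  have "N_position ([1, 1] @ [\<infinity>, \<infinity>])"
  proof (rule N_infinity_infinity_last)
    let ?U = "{[0, 0], [0, 1], [1, 0]}"
    show "finite ?U" by simp
    fix c r assume c: "1 \<le> c" and r: "take_tiles ([1, 1] @ [\<infinity>, enat c]) r"
    from r show "(\<exists>c'. r = [1, 1] @ [\<infinity>, enat c']) \<or> (\<exists>u\<in>?U. r = u @ [\<infinity>, enat c])"
    proof (cases rule: take_tiles_cases)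
      case pair
      then show ?thesis using c
        by (auto simp: pair_reduce_def zero_enat_def one_enat_def le_Suc_eq)
    qed (use c in \<open>auto simp: less_enat_iff zero_enat_def one_enat_def\<close>)
  qed simp
  then show ?thesis by simp
qed

lemma N_b_inf_1_1_inf_inf:
  assumes b: "1 \<le> b"
  shows "N_position [enat b, \<infinity>, 1, 1, \<infinity>, \<infinity>]"
proof -
  \<comment> \<open>The image covers both the first stack and the pair
    \<open>(b,\<infinity>)\<close>, since each only lowers \<open>b\<close>.\<close>
  let ?U = "{[enat b, \<infinity>, 0, 1], [enat b, \<infinity>, 0, 0], [enat b, \<infinity>, 1, 0]} \<union>
    (\<lambda>k. [enat k, \<infinity>, 1, 1]) ` {..<b}"
  have "N_position ([enat b, \<infinity>, 1, 1] @ [\<infinity>, \<infinity>])"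
  proof (rule N_infinity_infinity_last)
    show "0 \<notin> set [enat b, \<infinity>, 1, 1]" using b by (auto simp: enat_0_iff)
    show "finite ?U" by simp
    fix c r assume c: "1 \<le> c" and r: "take_tiles ([enat b, \<infinity>, 1, 1] @ [\<infinity>, enat c]) r"
    from r show "(\<exists>c'. r = [enat b, \<infinity>, 1, 1] @ [\<infinity>, enat c']) \<or> (\<exists>u\<in>?U. r = u @ [\<infinity>, enat c])"
    proof (cases rule: take_tiles_cases)
      case pair
      then show ?thesis using b c
        by (auto simp: pair_reduce_def zero_enat_def one_enat_def le_Suc_eq)
    qed (use b c in \<open>auto simp: less_enat_iff\<close>)
  qed
  then show ?thesis by simp
qed

section \<open>Reversal symmetry\<close>

lemma take_tiles_rev: "take_tiles p r \<Longrightarrow> take_tiles (rev p) (rev r)"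
proof (induction rule: take_tiles.induct)
  case (pair_fin k a b s t)
  then show ?case using take_tiles.pair_fin[of k b a "rev t" "rev s"] by simp
next
  case (pair_inf s t a)
  then show ?case using take_tiles.pair_inf[of "rev t" "rev s" a] by simp
next
  case (inf_fin b' b s t)
  then show ?case using take_tiles.fin_inf[of b' b "rev t" "rev s"] by simp
next
  case (fin_inf b' b s t)
  then show ?case using take_tiles.inf_fin[of b' b "rev t" "rev s"] by simp
qed (auto intro: take_tiles.intros)

lemma ident_rev: "ident r q \<Longrightarrow> ident (rev r) (rev q)"
proof (induction rule: ident.induct)
  case (ident_inner s x y t)
  then show ?case using ident.ident_inner[of "rev t" y x "rev s"] by (simp add: add.commute)
qed (auto intro: ident.intros)

lemma move_rev: "move p q \<Longrightarrow> move (rev p) (rev q)"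
proof -
  have "ident\<^sup>*\<^sup>* (rev r) (rev q)" if "ident\<^sup>*\<^sup>* r q" for r q
    using that by induction (auto intro: ident_rev rtranclp.rtrancl_into_rtrancl)
  then show "move p q \<Longrightarrow> move (rev p) (rev q)"
    unfolding move_def using take_tiles_rev by (metis set_rev)
qed

lemma P_position_rev: "P_position (rev p) \<longleftrightarrow> P_position p"
proof (induction p rule: wf_induct_rule[OF wf_move])
  case (1 p)
  then have "P_position (rev q) \<longleftrightarrow> P_position q" if "move p q" for q using that by simp
  then show ?case using move_rev[of p] move_rev[of "rev p"]
    unfolding P_position_iff[of p] P_position_iff[of "rev p"] by (metis rev_rev_ident)
qed

lemma N_position_rev: "N_position (rev p) \<longleftrightarrow> N_position p"
  by (simp add: N_iff_not_P P_position_rev)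

section \<open>Explicit answers and the two P positions\<close>

lemma N_inf_inf: "N_position [\<infinity>, \<infinity>]"
proof (rule N_positionI)
  show "move [\<infinity>, \<infinity>] []"
    using take_tiles_imp_move[OF take_tiles.pair_inf[of "[]" "[]" 0]] by (simp add: zero_enat_def)
  have "\<not> take_tiles [] r" for r
    by (auto elim: take_tiles.cases)
  then show "P_position []" by (intro P_take_tilesI) blast
qed

text \<open>Every pair move collapses to \<open>[\<infinity>, \<infinity>]\<close>, because a
  remaining 1 is absorbed; reducing an end leaves, up to reversal, a pigeonhole N position.\<close>

lemma P_inf_1_1_inf: "P_position [\<infinity>, 1, 1, \<infinity>]"
proof (rule P_take_tilesI)
  have left: "N_position (collapse [enat a, 1, 1, \<infinity>])" for a
    using N_a_1_1_inf[of a] N_1_1_inf by (cases "a = 0") (auto simp: enat_0_iff)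
  have right: "N_position (collapse [\<infinity>, 1, 1, enat a])" for a
    using N_a_1_1_inf[of a] N_1_1_inf N_position_rev[of "[enat a, 1, 1, \<infinity>]"]
      N_position_rev[of "[1, 1, \<infinity>]"]
    by (cases "a = 0") (auto simp: enat_0_iff)
  fix r assume "take_tiles [\<infinity>, 1, 1, \<infinity>] r"
  then show "N_position (collapse r)"
  proof (cases rule: take_tiles_cases)
    case pair
    then show ?thesis using N_inf_inf
      by (auto simp: pair_reduce_def zero_enat_def one_enat_def le_Suc_eq)
  qed (use left right in \<open>auto simp: less_enat_iff simp del: collapse.simps\<close>)
qed

text \<open>Removing the whole last stack leaves the P position
  \<open>[\<infinity>, 1, 1, \<infinity>]\<close>.\<close>

lemma N_inf_1_1_inf_inf: "N_position [\<infinity>, 1, 1, \<infinity>, \<infinity>]"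
  using N_positionI[OF _ P_inf_1_1_inf] move_last[of "[\<infinity>, 1, 1, \<infinity>]" 0 \<infinity>] by simp

text \<open>Reducing the middle pair to \<open>(1,1)\<close> is the winning move.\<close>

lemma N_inf_inf_inf_inf: "N_position [\<infinity>, \<infinity>, \<infinity>, \<infinity>]"
  using N_positionI[OF take_tiles_imp_move[OF take_tiles.pair_inf[of "[\<infinity>]" "[\<infinity>]" 1, folded one_enat_def]]] P_inf_1_1_inf
  by simp

lemma P_inf_inf_1_1_inf_inf: "P_position [\<infinity>, \<infinity>, 1, 1, \<infinity>, \<infinity>]"
proof (rule P_take_tilesI)
  have first: "N_position (collapse [enat b, \<infinity>, 1, 1, \<infinity>, \<infinity>])" for b
    using N_b_inf_1_1_inf_inf[of b] N_inf_1_1_inf_inf by (cases "b = 0") (auto simp: enat_0_iff)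
  have last: "N_position (collapse [\<infinity>, \<infinity>, 1, 1, \<infinity>, enat b])" for b
    using N_b_inf_1_1_inf_inf[of b] N_inf_1_1_inf_inf
      N_position_rev[of "[enat b, \<infinity>, 1, 1, \<infinity>, \<infinity>]"] N_position_rev[of "[\<infinity>, 1, 1, \<infinity>, \<infinity>]"]
    by (cases "b = 0") (auto simp: enat_0_iff)
  \<comment> \<open>For \<open>b = 0\<close> both end stacks vanish, which leaves
    \<open>[1, 1, \<infinity>, \<infinity>]\<close>.\<close>
  have left: "N_position (collapse [enat b, enat b, 1, 1, \<infinity>, \<infinity>])" for b
    using N_b_b_1_1_inf_inf[of b] N_1_1_inf_inf by (cases "b = 0") (auto simp: enat_0_iff)
  have right: "N_position (collapse [\<infinity>, \<infinity>, 1, 1, enat b, enat b])" for b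
    using N_b_b_1_1_inf_inf[of b] N_1_1_inf_inf
      N_position_rev[of "[enat b, enat b, 1, 1, \<infinity>, \<infinity>]"] N_position_rev[of "[1, 1, \<infinity>, \<infinity>]"]
    by (cases "b = 0") (auto simp: enat_0_iff simp flip: zero_enat_def)
  \<comment> \<open>The neighboring infinite stacks absorb what is left in the middle, so all three
    cases collapse to four infinite stacks.\<close>
  have mid: "N_position (collapse [\<infinity>, \<infinity>, x, y, \<infinity>, \<infinity>])"
    if "(x, y) \<in> {(0, 0), (0, 1), (1, 0)}" for x y
    using that N_inf_inf_inf_inf by auto
  fix r assume "take_tiles [\<infinity>, \<infinity>, 1, 1, \<infinity>, \<infinity>] r"
  then show "N_position (collapse r)"
  proof (cases rule: take_tiles_cases)
    case pair
    then have "(\<exists>b. r = [enat b, enat b, 1, 1, \<infinity>, \<infinity>]) \<or> (\<exists>b. r = [\<infinity>, \<infinity>, 1, 1, enat b, enat b]) \<or>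
      (\<exists>x y. r = [\<infinity>, \<infinity>, x, y, \<infinity>, \<infinity>] \<and> (x, y) \<in> {(0, 0), (0, 1), (1, 0)})"
      by (auto simp: pair_reduce_def zero_enat_def one_enat_def le_Suc_eq)
    then show ?thesis using left right mid by blast
  qed (use first last in \<open>auto simp: less_enat_iff simp del: collapse.simps\<close>)
qed

theorem theorem23: "N_position [\<infinity>, \<infinity>, \<infinity>, \<infinity>, \<infinity>, \<infinity>]"
  using N_positionI[OF take_tiles_imp_move[OF take_tiles.pair_inf[of "[\<infinity>, \<infinity>]" "[\<infinity>, \<infinity>]" 1, folded one_enat_def]]]
    P_inf_inf_1_1_inf_inf
  by simp

end
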